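(* Let $u_0\in L^\infty(\mathbb R)\cap C^1(\mathbb R\setminus\{0\})$ satisfy $\lim_{|x|\rightarrow+\infty}|x\,u_0'(x)|=0$. Then the set of accumulation points in $L^\infty_{loc}(\mathbb R)$ of $\{(e^{\triangle t}u_0)(\sqrt t\,\cdot\,)\}_{t>0}$ as $t\rightarrow+\infty$ coincides with the set $$\{\alpha F(-\,\cdot\,)+\beta F(+\,\cdot\,)\ |\ (\alpha,\beta)\in A\},$$ where $F(z):=\frac{1}{2\sqrt\pi}\int_{-\infty}^z e^{-\frac{y^2}{4}}\,dy$ and $A$ is the set of accumulation points in $\mathbb R^2$ of $\{(u_0(-\lambda),u_0(+\lambda))\}_{\lambda>0}$ as $\lambda\rightarrow+\infty$.
   Context: $e^{\triangle t}$ denotes the heat semigroup on $\mathbb R$: $(e^{\triangle t}u_0)(x)=\frac{1}{2\sqrt{\pi t}}\int_{-\infty}^{+\infty}e^{-\frac{(x-y)^2}{4t}}u_0(y)\,dy$ for $t>0$, i.e. the solution at time $t$ of $u_t=u_{xx}$ with initial value $u_0$. The expression $(e^{\triangle t}u_0)(\sqrt t\,\cdot\,)$ denotes the function $x\mapsto(e^{\triangle t}u_0)(\sqrt t\,x)$. An accumulation point of a family $\{f_t\}_{t>0}$ as $t\rightarrow+\infty$ is a limit of $f_{t_n}$ along some sequence $t_n\rightarrow+\infty$; convergence in $L^\infty_{loc}(\mathbb R)$ is convergence in $L^\infty([-L,L])$ for every $L>0$. The condition $u_0\in L^\infty(\mathbb R)\cap C^1(\mathbb R\setminus\{0\})$ means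 that $u_0$ is bounded and continuously differentiable on $\mathbb R\setminus\{0\}$; no regularity at $0$ is assumed. *)

theory Defs
  imports "HOL-Analysis.Analysis" "HOL-Probability.Essential_Supremum"
begin

definition heat_semigroup :: "real \<Rightarrow> (real \<Rightarrow> real) \<Rightarrow> real \<Rightarrow> real" where
  "heat_semigroup t u x =
     1 / (2 * sqrt (pi * t)) * (LINT y|lebesgue. exp (- ((x - y)\<^sup>2 / (4 * t))) * u y)"

definition F :: "real \<Rightarrow> real" where
  "F z = 1 / (2 * sqrt pi) * (LINT y:{..z}|lebesgue. exp (- (y\<^sup>2 / 4)))"

text \<open>Representatives of elements of the space of locally essentially bounded functions;
  the elements themselves are the classes formed by \<open>Linf_loc_class\<close>.\<close>

definition Linf_loc :: "(real \<Rightarrow> real) set" where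
  "Linf_loc = {f \<in> borel_measurable lebesgue.
     \<forall>L>0. esssup (lebesgue_on {-L..L}) (\<lambda>x. ereal \<bar>f x\<bar>) < \<infinity>}"

definition Linf_loc_class :: "(real \<Rightarrow> real) \<Rightarrow> (real \<Rightarrow> real) set" where
  "Linf_loc_class f = {g \<in> Linf_loc. AE x in lebesgue. g x = f x}"

definition Linf_loc_tendsto :: "(nat \<Rightarrow> real \<Rightarrow> real) \<Rightarrow> (real \<Rightarrow> real) \<Rightarrow> bool" where
  "Linf_loc_tendsto f g \<longleftrightarrow>
     (\<forall>L>0. (\<lambda>n. esssup (lebesgue_on {-L..L}) (\<lambda>x. ereal \<bar>f n x - g x\<bar>)) \<longlonglongrightarrow> 0)"

definition Linf_loc_accumulation_points ::
  "(real \<Rightarrow> real \<Rightarrow> real) \<Rightarrow> (real \<Rightarrow> real) set set" where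
  "Linf_loc_accumulation_points f =
     {Linf_loc_class g | g. g \<in> Linf_loc \<and>
        (\<exists>t :: nat \<Rightarrow> real. (\<forall>n. 0 < t n) \<and> filterlim t at_top sequentially \<and>
           Linf_loc_tendsto (\<lambda>n. f (t n)) g)}"

definition accumulation_points :: "(real \<Rightarrow> 'a::topological_space) \<Rightarrow> 'a set" where
  "accumulation_points f =
     {p. \<exists>t :: nat \<Rightarrow> real. (\<forall>n. 0 < t n) \<and> filterlim t at_top sequentially \<and>
           (\<lambda>n. f (t n)) \<longlonglongrightarrow> p}"

end

theory Submission
  imports Defs "HOL-Probability.Distributions"
begin

text \<open>
  The substitution $y = \sqrt t\, z$ turns $(e^{\triangle t}u_0)(\sqrt t\,x)$ into the Gaussian average
  around $x$ of the dilated function $z \mapsto u_0(\sqrt t\,z)$. The decay of $x\,u_0'(x)$ says that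
  $s \mapsto u_0(\pm e^s)$ has vanishing derivative at infinity, so that
  $u_0(\pm\lambda a) - u_0(\pm\lambda) \to 0$ for each $a > 0$: along $t_n$ with
  $(u_0(-\sqrt{t_n}), u_0(\sqrt{t_n})) \to (\alpha,\beta)$ the dilations converge pointwise off $0$ to the
  step function with values $\alpha$, $\beta$, whose Gaussian average is $\alpha F(-x) + \beta F(x)$.
  Dominated convergence makes this locally uniform. Conversely, along any $t_n \to \infty$ the bounded
  sequence of pairs has a convergent subsequence, which identifies the limit of the rescaled solutions.
\<close>

section \<open>Slow variation at infinity\<close>

text \<open>In the logarithmic variable \<open>s\<close> the function \<open>f (exp s)\<close> has
  derivative \<open>exp s * f' (exp s)\<close>, which tends to 0, while \<open>ln (l * a)\<close>
  and \<open>ln l\<close> stay at the fixed distance \<open>\<bar>ln a\<bar>\<close>. The mean value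
  inequality then applies.\<close>

lemma slowly_varying_at_top:
  fixes f f' :: "real \<Rightarrow> real"
  assumes deriv: "\<And>x. x > 0 \<Longrightarrow> (f has_real_derivative f' x) (at x)"
    and lim: "((\<lambda>x. x * f' x) \<longlongrightarrow> 0) at_top"
    and "a > 0"
  shows "((\<lambda>l. f (l * a) - f l) \<longlongrightarrow> 0) at_top"
proof (rule tendstoI)
  fix e :: real assume "e > 0"
  \<comment> \<open>The summand 1 avoids division by zero at \<open>a = 1\<close> and makes
    \<open>d * \<bar>ln a\<bar> < e\<close> strict.\<close>
  define d where "d = e / (\<bar>ln a\<bar> + 1)"
  have "d > 0" using \<open>e > 0\<close> by (simp add: d_def add_nonneg_pos)
  obtain R where R: "\<And>x. x \<ge> R \<Longrightarrow> \<bar>x * f' x\<bar> < d"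
    using tendstoD[OF lim \<open>d > 0\<close>] by (auto simp: eventually_at_top_linorder dist_real_def)
  have bound: "\<bar>f (l * a) - f l\<bar> < e" if "l > 0" "l \<ge> R" "l \<ge> R / a" for l
  proof -
    \<comment> \<open>A half-line is convex and contains both logarithms whether \<open>a\<close> is
      below or above 1; the two bounds on \<open>l\<close> keep \<open>exp\<close> of it above
      \<open>R\<close>.\<close>
    let ?S = "{min (ln (l * a)) (ln l)..}"
    have big: "exp s \<ge> R" if "s \<in> ?S" for s
    proof -
      have "R \<le> min (l * a) l" using \<open>l \<ge> R\<close> \<open>l \<ge> R / a\<close> \<open>a > 0\<close> by (simp add: field_simps)
      also have "\<dots> = exp (min (ln (l * a)) (ln l))"
        using \<open>l > 0\<close> \<open>a > 0\<close> by (simp add: min_def)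
      also have "\<dots> \<le> exp s" using that by simp
      finally show ?thesis .
    qed
    have "norm (f (exp (ln (l * a))) - f (exp (ln l))) \<le> d * norm (ln (l * a) - ln l)"
    proof (rule field_differentiable_bound[where S = ?S and f = "\<lambda>s. f (exp s)"
          and f' = "\<lambda>s. exp s * f' (exp s)"])
      show "((\<lambda>s. f (exp s)) has_field_derivative exp s * f' (exp s)) (at s within ?S)" for s
        by (rule has_field_derivative_at_within)
          (use DERIV_chain2[OF deriv DERIV_exp, of s] in \<open>simp add: mult.commute\<close>)
      show "norm (exp s * f' (exp s)) \<le> d" if "s \<in> ?S" for s
        using R[OF big[OF that]] by simp
    qed auto
    also have "norm (ln (l * a) - ln l) = \<bar>ln a\<bar>"
      using \<open>l > 0\<close> \<open>a > 0\<close> by (simp add: ln_mult)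
    also have "d * \<bar>ln a\<bar> < e"
      using \<open>e > 0\<close> by (simp add: d_def field_simps add_nonneg_pos)
    finally show ?thesis using \<open>l > 0\<close> \<open>a > 0\<close> by simp
  qed
  show "\<forall>\<^sub>F l in at_top. dist (f (l * a) - f l) 0 < e"
    using eventually_gt_at_top[of 0] eventually_ge_at_top[of R] eventually_ge_at_top[of "R / a"]
    by eventually_elim (auto simp: dist_real_def intro: bound)
qed

section \<open>Convergence in the space of locally bounded functions\<close>

text \<open>The bound by the essential supremum holds off a null set common to all \<open>n\<close>,
  and countably many intervals exhaust the line. This serves to identify two limits almost
  everywhere.\<close>

lemma Linf_loc_tendsto_imp_AE:
  assumes "Linf_loc_tendsto f g"
  shows "AE x in lebesgue. (\<lambda>n. f n x) \<longlonglongrightarrow> g x"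
proof -
  \<comment> \<open>\<open>Suc k\<close> because convergence is assumed only for
    \<open>L > 0\<close>.\<close>
  have "AE x in lebesgue. x \<in> {- real (Suc k)..real (Suc k)} \<longrightarrow> (\<lambda>n. f n x) \<longlonglongrightarrow> g x" for k
  proof -
    let ?S = "{- real (Suc k)..real (Suc k)}"
    define s where "s n = esssup (lebesgue_on ?S) (\<lambda>x. ereal \<bar>f n x - g x\<bar>)" for n
    have s: "s \<longlonglongrightarrow> 0"
      using assms[unfolded Linf_loc_tendsto_def, rule_format, of "real (Suc k)"]
      unfolding s_def[abs_def] by simp
    have "AE x in lebesgue_on ?S. \<forall>n. ereal \<bar>f n x - g x\<bar> \<le> s n"
      unfolding s_def by (subst AE_all_countable) (intro allI esssup_AE)
    then have "AE x in lebesgue. x \<in> ?S \<longrightarrow> (\<forall>n. ereal \<bar>f n x - g x\<bar> \<le> s n)"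
      by (subst (asm) AE_restrict_space_iff) auto
    then show ?thesis
    proof (eventually_elim, safe)
      fix x assume "\<forall>n. ereal \<bar>f n x - g x\<bar> \<le> s n"
      then have "(\<lambda>n. ereal \<bar>f n x - g x\<bar>) \<longlonglongrightarrow> 0"
        by (intro tendsto_sandwich[OF _ _ tendsto_const s]) auto
      then show "(\<lambda>n. f n x) \<longlonglongrightarrow> g x"
        by (simp add: zero_ereal_def tendsto_rabs_zero_iff LIM_zero_iff)
    qed
  qed
  then have "AE x in lebesgue. \<forall>k. x \<in> {- real (Suc k)..real (Suc k)} \<longrightarrow> (\<lambda>n. f n x) \<longlonglongrightarrow> g x"
    by (subst AE_all_countable) blast
  then show ?thesis
  proof eventually_elim
    case (elim x)
    obtain k where "\<bar>x\<bar> \<le> real k" using real_arch_simple by blast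
    then have "x \<in> {- real (Suc k)..real (Suc k)}" by (auto simp: abs_le_iff)
    with elim show ?case by blast
  qed
qed

text \<open>The bound separates \<open>L\<close> from \<open>n\<close> and does not involve
  \<open>x\<close>, so one scalar null sequence \<open>e\<close> controls every interval.\<close>

lemma Linf_loc_tendstoI:
  assumes "\<And>n. f n \<in> borel_measurable lebesgue" "g \<in> borel_measurable lebesgue"
    and bound: "\<And>L n x. L > 0 \<Longrightarrow> \<bar>x\<bar> \<le> L \<Longrightarrow> \<bar>f n x - g x\<bar> \<le> C L * e n"
    and "e \<longlonglongrightarrow> 0"
  shows "Linf_loc_tendsto f g"
  unfolding Linf_loc_tendsto_def
proof (intro allI impI)
  fix L :: real assume "L > 0"
  let ?M = "lebesgue_on {-L..L}"
  let ?h = "\<lambda>n x. ereal \<bar>f n x - g x\<bar>"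
  have [measurable]: "f n \<in> borel_measurable ?M" "g \<in> borel_measurable ?M" for n
    using assms(1,2) by (auto intro: measurable_restrict_space1)
  \<comment> \<open>On a space of measure zero the essential supremum of a measurable function is
    minus infinity, so the lower bound 0 rests on the interval having positive length.\<close>
  have "emeasure ?M (space ?M) \<noteq> 0" using \<open>L > 0\<close>
    by (simp add: emeasure_restrict_space)
  then have lower: "\<forall>\<^sub>F n in sequentially. 0 \<le> esssup ?M (?h n)"
    using esssup_mono[of "\<lambda>_. 0" ?M "?h _"] by (intro always_eventually) (simp add: esssup_const)
  have "esssup ?M (?h n) \<le> ereal (C L * e n)" for n
  proof (rule esssup_I)
    show "AE x in ?M. ?h n x \<le> ereal (C L * e n)"
      using \<open>L > 0\<close> by (intro AE_I2) (auto simp: space_restrict_space intro!: bound)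
  qed measurable
  then have upper: "\<forall>\<^sub>F n in sequentially. esssup ?M (?h n) \<le> ereal (C L * e n)"
    by simp
  have "(\<lambda>n. ereal (C L * e n)) \<longlonglongrightarrow> 0"
    using tendsto_mult_right_zero[OF \<open>e \<longlonglongrightarrow> 0\<close>, of "C L"] by (simp add: zero_ereal_def)
  then show "(\<lambda>n. esssup ?M (?h n)) \<longlonglongrightarrow> 0"
    by (rule tendsto_sandwich[OF lower upper tendsto_const])
qed

section \<open>Gaussian integrals, the heat kernel and the profile \<open>F\<close>\<close>

lemma integrable_gaussian:
  fixes x c :: real
  assumes "c > 0"
  shows "integrable lborel (\<lambda>z. exp (- ((x - z)\<^sup>2 / c)))"
proof -
  have "(\<lambda>z. exp (- ((x - z)\<^sup>2 / c))) = (\<lambda>z. sqrt (pi * c) * normal_density x (sqrt (c / 2)) z)"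
    using assms by (auto simp: normal_density_def power2_commute[of x])
  moreover have "0 < sqrt (c / 2)" using assms by simp
  ultimately show ?thesis by (simp add: integrable_normal_density)
qed

text \<open>The Jacobian \<open>sqrt t\<close> of the substitution cancels the \<open>sqrt t\<close>
  of the normalisation, so time survives only in the dilation of \<open>u\<close>. Borel
  measurability allows the passage from \<open>lebesgue\<close> to \<open>lborel\<close>.\<close>

lemma heat_semigroup_rescaled:
  assumes [measurable]: "u \<in> borel_measurable borel" and "t > 0"
  shows "heat_semigroup t u (sqrt t * x) =
    1 / (2 * sqrt pi) * (LINT z|lborel. exp (- ((x - z)\<^sup>2 / 4)) * u (sqrt t * z))"
proof -
  have "(LINT y|lebesgue. exp (- ((sqrt t * x - y)\<^sup>2 / (4 * t))) * u y) =
      (LINT y|lborel. exp (- ((sqrt t * x - y)\<^sup>2 / (4 * t))) * u y)"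
    by (rule integral_completion) measurable
  also have "\<dots> = sqrt t * (LINT z|lborel. exp (- ((sqrt t * x - sqrt t * z)\<^sup>2 / (4 * t))) * u (sqrt t * z))"
    using \<open>t > 0\<close> by (subst lborel_integral_real_affine[where c = "sqrt t" and t = 0]) auto
  also have "(\<lambda>z. exp (- ((sqrt t * x - sqrt t * z)\<^sup>2 / (4 * t)))) = (\<lambda>z. exp (- ((x - z)\<^sup>2 / 4)))"
    using \<open>t > 0\<close> by (auto simp: right_diff_distrib[symmetric] power_mult_distrib)
  finally show ?thesis
    using \<open>t > 0\<close> by (simp add: heat_semigroup_def real_sqrt_mult)
qed

lemma F_eq_lborel:
  "F z = 1 / (2 * sqrt pi) * (LINT y|lborel. indicator {..z} y * exp (- (y\<^sup>2 / 4)))"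
  unfolding F_def set_lebesgue_integral_def by (subst integral_completion) auto

lemma F_measurable [measurable]: "F \<in> borel_measurable borel"
proof -
  \<comment> \<open>The conditional turns the moving half-line into a predicate jointly measurable
    in \<open>y\<close> and \<open>z\<close>.\<close>
  have "F = (\<lambda>z. 1 / (2 * sqrt pi) * (LINT y|lborel. (if y \<le> z then 1 else 0) * exp (- (y\<^sup>2 / 4))))"
    by (auto simp: F_eq_lborel indicator_def fun_eq_iff intro!: Bochner_Integration.integral_cong)
  also have "\<dots> \<in> borel_measurable borel" by measurable
  finally show ?thesis .
qed

lemma abs_F_le: "\<bar>F z\<bar> \<le> 1 / (2 * sqrt pi) * (LINT y|lborel. exp (- (y\<^sup>2 / 4)))"
proof -
  have int: "integrable lborel (\<lambda>y::real. exp (- (y\<^sup>2 / 4)))"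
    using integrable_gaussian[of 4 0] by simp
  have "\<bar>LINT y|lborel. indicator {..z} y * exp (- (y\<^sup>2 / 4))\<bar> \<le> (LINT y|lborel. exp (- (y\<^sup>2 / 4)))"
    by (rule integral_abs_bound[THEN order_trans], rule integral_mono'[OF int])
      (auto simp: indicator_def)
  then show ?thesis
    by (simp add: F_eq_lborel abs_mult divide_right_mono)
qed

text \<open>The normalised Gaussian centred at \<open>x\<close> puts mass \<open>F (- x)\<close> on
  the left half-line and \<open>F x\<close> on the right one.\<close>

lemma gaussian_step_integral:
  "1 / (2 * sqrt pi) * (LINT z|lborel. exp (- ((x - z)\<^sup>2 / 4)) * (if z < 0 then \<alpha> else \<beta>)) =
    \<alpha> * F (- x) + \<beta> * F x"
proof -
  let ?k = "\<lambda>z. exp (- ((x - z)\<^sup>2 / 4))"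
  have int: "integrable lborel (\<lambda>z. indicator {..0} z * ?k z)" "integrable lborel (\<lambda>z. indicator {0..} z * ?k z)"
    using integrable_mult_indicator[OF _ integrable_gaussian[of 4 x], of "{..0}"]
      integrable_mult_indicator[OF _ integrable_gaussian[of 4 x], of "{0..}"] by simp_all
  have "(LINT z|lborel. ?k z * (if z < 0 then \<alpha> else \<beta>)) =
      (LINT z|lborel. \<alpha> * (indicator {..0} z * ?k z) + \<beta> * (indicator {0..} z * ?k z))"
    \<comment> \<open>Both closed half-lines contain 0, so the integrands agree only almost
      everywhere.\<close>
    by (rule integral_cong_AE, measurable, use AE_lborel_singleton[of 0] in eventually_elim)
      (auto simp: indicator_def)
  also have "\<dots> = \<alpha> * (LINT z|lborel. indicator {..0} z * ?k z) + \<beta> * (LINT z|lborel. indicator {0..} z * ?k z)"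
    using int by simp
  also have "(LINT z|lborel. indicator {..0} z * ?k z) = 2 * sqrt pi * F (- x)"
    unfolding F_eq_lborel
    by (subst lborel_integral_real_affine[where c = 1 and t = x])
      (auto simp: indicator_def intro!: Bochner_Integration.integral_cong)
  also have "(LINT z|lborel. indicator {0..} z * ?k z) = 2 * sqrt pi * F x"
    unfolding F_eq_lborel
    \<comment> \<open>The reflection \<open>z = x - y\<close> carries \<open>{0..}\<close> to
      \<open>{..x}\<close>; the translation above carries \<open>{..0}\<close> to
      \<open>{..-x}\<close>.\<close>
    by (subst lborel_integral_real_affine[where c = "-1" and t = x])
      (auto simp: indicator_def intro!: Bochner_Integration.integral_cong)
  finally show ?thesis by (simp add: field_simps)
qed

lemma F_combination_in_Linf_loc: "(\<lambda>x. \<alpha> * F (- x) + \<beta> * F x) \<in> Linf_loc"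
proof -
  let ?w = "\<lambda>x. \<alpha> * F (- x) + \<beta> * F x"
  define B where "B = 1 / (2 * sqrt pi) * (LINT y|lborel. exp (- (y\<^sup>2 / 4)))"
  have [measurable]: "?w \<in> borel_measurable lebesgue"
    by (rule measurable_completion) measurable
  have "esssup (lebesgue_on {-L..L}) (\<lambda>x. ereal \<bar>?w x\<bar>) < \<infinity>" for L
  proof -
    have [measurable]: "?w \<in> borel_measurable (lebesgue_on {-L..L})"
      by (rule measurable_restrict_space1) measurable
    have "\<bar>?w x\<bar> \<le> \<bar>\<alpha>\<bar> * B + \<bar>\<beta>\<bar> * B" for x
      using abs_F_le[of x] abs_F_le[of "-x"] unfolding B_def
      by (intro abs_triangle_ineq[THEN order_trans] add_mono) (simp_all only: abs_mult mult_left_mono abs_ge_zero)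
    then have "esssup (lebesgue_on {-L..L}) (\<lambda>x. ereal \<bar>?w x\<bar>) \<le> ereal (\<bar>\<alpha>\<bar> * B + \<bar>\<beta>\<bar> * B)"
      by (intro esssup_I AE_I2) simp_all
    then show ?thesis by (rule le_less_trans) simp
  qed
  then show ?thesis by (simp add: Linf_loc_def)
qed

text \<open>Widening the Gaussian absorbs the shift: after multiplication by 8 and replacement of
  \<open>L\<close> by \<open>x\<close>, the exponents differ by exactly
  \<open>(2 * x - z)\<^sup>2\<close>. The resulting majorant is integrable in \<open>z\<close> and
  uniform in \<open>\<bar>x\<bar> \<le> L\<close>.\<close>

lemma gaussian_translate_le:
  fixes x z L :: real
  assumes "\<bar>x\<bar> \<le> L"
  shows "exp (- ((x - z)\<^sup>2 / 4)) \<le> exp (L\<^sup>2 / 4) * exp (- (z\<^sup>2 / 8))"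
proof -
  have "x\<^sup>2 \<le> L\<^sup>2" using assms by (simp add: abs_le_square_iff[symmetric])
  moreover have "0 \<le> (2 * x - z)\<^sup>2" by simp
  ultimately have "- ((x - z)\<^sup>2 / 4) \<le> L\<^sup>2 / 4 + - (z\<^sup>2 / 8)"
    by (simp add: power2_eq_square field_simps)
  then show ?thesis by (simp add: exp_add[symmetric])
qed

lemma integrable_gaussian_bounded:
  fixes v :: "real \<Rightarrow> real"
  assumes [measurable]: "v \<in> borel_measurable borel" and "\<And>z. \<bar>v z\<bar> \<le> K" and "c > 0"
  shows "integrable lborel (\<lambda>z. exp (- ((x - z)\<^sup>2 / c)) * v z)"
proof (rule Bochner_Integration.integrable_bound)
  show "integrable lborel (\<lambda>z. K * exp (- ((x - z)\<^sup>2 / c)))"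
    using integrable_gaussian[OF \<open>c > 0\<close>] by simp
  show "AE z in lborel. norm (exp (- ((x - z)\<^sup>2 / c)) * v z) \<le> norm (K * exp (- ((x - z)\<^sup>2 / c)))"
    using assms(2) by (intro AE_I2) (simp add: abs_mult mult.commute mult_right_mono order_trans[OF _ abs_ge_self])
qed measurable

lemma heat_rescaled_measurable:
  assumes [measurable]: "u \<in> borel_measurable borel" and "t > 0"
  shows "(\<lambda>x. heat_semigroup t u (sqrt t * x)) \<in> borel_measurable lebesgue"
  unfolding heat_semigroup_rescaled[OF assms]
  by (rule measurable_completion) measurable

section \<open>Rescaled heat flow of bounded data\<close>

context
  fixes u :: "real \<Rightarrow> real" and B :: real
  assumes u_measurable [measurable]: "u \<in> borel_measurable borel"
    and u_bounded: "\<And>x. \<bar>u x\<bar> \<le> B"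
begin

text \<open>With the profile written as the Gaussian average of a step function, the difference is a
  single average, and the uniform majorant removes \<open>x\<close> from the integral.\<close>

lemma heat_step_bound:
  assumes "t > 0" "\<bar>x\<bar> \<le> L"
  shows "\<bar>heat_semigroup t u (sqrt t * x) - (\<alpha> * F (- x) + \<beta> * F x)\<bar> \<le>
    exp (L\<^sup>2 / 4) / (2 * sqrt pi) *
      (LINT z|lborel. exp (- (z\<^sup>2 / 8)) * \<bar>u (sqrt t * z) - (if z < 0 then \<alpha> else \<beta>)\<bar>)"
proof -
  let ?v = "\<lambda>z. u (sqrt t * z)"
  let ?w = "\<lambda>z::real. if z < 0 then \<alpha> else \<beta>"
  let ?k = "\<lambda>z. exp (- ((x - z)\<^sup>2 / 4))"
  have vw: "\<bar>?v z - ?w z\<bar> \<le> B + (\<bar>\<alpha>\<bar> + \<bar>\<beta>\<bar>)" for z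
    using u_bounded[of "sqrt t * z"] by (auto simp: abs_le_iff)
  have "integrable lborel (\<lambda>z. ?k z * ?v z)"
    by (rule integrable_gaussian_bounded[where K = B]) (use u_bounded in auto)
  moreover have "integrable lborel (\<lambda>z. ?k z * ?w z)"
    by (rule integrable_gaussian_bounded[where K = "\<bar>\<alpha>\<bar> + \<bar>\<beta>\<bar>"]) auto
  ultimately have "heat_semigroup t u (sqrt t * x) - (\<alpha> * F (- x) + \<beta> * F x) =
      1 / (2 * sqrt pi) * (LINT z|lborel. ?k z * (?v z - ?w z))"
    by (simp add: heat_semigroup_rescaled[OF u_measurable \<open>t > 0\<close>] gaussian_step_integral[symmetric]
        right_diff_distrib diff_divide_distrib)
  moreover have "\<bar>LINT z|lborel. ?k z * (?v z - ?w z)\<bar> \<le>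
      (LINT z|lborel. exp (L\<^sup>2 / 4) * (exp (- (z\<^sup>2 / 8)) * \<bar>?v z - ?w z\<bar>))"
  proof (rule integral_abs_bound[THEN order_trans], rule integral_mono')
    show "integrable lborel (\<lambda>z. exp (L\<^sup>2 / 4) * (exp (- (z\<^sup>2 / 8)) * \<bar>?v z - ?w z\<bar>))"
      using integrable_gaussian_bounded[of "\<lambda>z. \<bar>?v z - ?w z\<bar>" "B + (\<bar>\<alpha>\<bar> + \<bar>\<beta>\<bar>)" 8 0] vw by simp
    show "\<bar>?k z * (?v z - ?w z)\<bar> \<le> exp (L\<^sup>2 / 4) * (exp (- (z\<^sup>2 / 8)) * \<bar>?v z - ?w z\<bar>)" for z
      unfolding abs_mult mult.assoc[symmetric]
      using gaussian_translate_le[OF \<open>\<bar>x\<bar> \<le> L\<close>, of z] by (intro mult_right_mono) auto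
  qed auto
  ultimately show ?thesis
    by (simp add: abs_mult divide_right_mono)
qed

text \<open>All dependence on \<open>n\<close> sits in one error integral, so a single use of
  dominated convergence gives convergence on every interval.\<close>

lemma heat_rescaled_tendsto:
  assumes pos: "\<And>a. a > 0 \<Longrightarrow> ((\<lambda>l. u (l * a) - u l) \<longlongrightarrow> 0) at_top"
    and neg: "\<And>a. a > 0 \<Longrightarrow> ((\<lambda>l. u (- (l * a)) - u (- l)) \<longlongrightarrow> 0) at_top"
    and t: "\<And>n. t n > 0" "filterlim t at_top sequentially"
    and \<alpha>: "(\<lambda>n. u (- sqrt (t n))) \<longlonglongrightarrow> \<alpha>" and \<beta>: "(\<lambda>n. u (sqrt (t n))) \<longlonglongrightarrow> \<beta>"
  shows "Linf_loc_tendsto (\<lambda>n x. heat_semigroup (t n) u (sqrt (t n) * x))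
    (\<lambda>x. \<alpha> * F (- x) + \<beta> * F x)"
proof (rule Linf_loc_tendstoI)
  let ?w = "\<lambda>z::real. if z < 0 then \<alpha> else \<beta>"
  let ?d = "\<lambda>n z. exp (- (z\<^sup>2 / 8)) * \<bar>u (sqrt (t n) * z) - ?w z\<bar>"
  have s: "filterlim (\<lambda>n. sqrt (t n)) at_top sequentially"
    using t(2) sqrt_at_top by (rule filterlim_compose[rotated])
  have "(\<lambda>n. LINT z|lborel. ?d n z) \<longlonglongrightarrow> (LINT z::real|lborel. (0::real))"
  proof (rule integral_dominated_convergence[where w = "\<lambda>z. exp (- (z\<^sup>2 / 8)) * (B + (\<bar>\<alpha>\<bar> + \<bar>\<beta>\<bar>))"])
    show "integrable lborel (\<lambda>z::real. exp (- (z\<^sup>2 / 8)) * (B + (\<bar>\<alpha>\<bar> + \<bar>\<beta>\<bar>)))"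
      using integrable_gaussian[of 8 0] by simp
    have "\<bar>u y - ?w z\<bar> \<le> B + (\<bar>\<alpha>\<bar> + \<bar>\<beta>\<bar>)" for y z
      using u_bounded[of y] by (auto simp: abs_le_iff)
    then show "AE z in lborel. norm (?d n z) \<le> exp (- (z\<^sup>2 / 8)) * (B + (\<bar>\<alpha>\<bar> + \<bar>\<beta>\<bar>))" for n
      by (simp add: abs_mult)
    show "AE z in lborel. (\<lambda>n. ?d n z) \<longlonglongrightarrow> 0"
      \<comment> \<open>At \<open>z = 0\<close> the dilations have the constant value
        \<open>u 0\<close>, unrelated to \<alpha> and \<beta>; this point is discarded.\<close>
      using AE_lborel_singleton[of 0]
    proof eventually_elim
      case (elim z)
      have "(\<lambda>n. u (sqrt (t n) * z)) \<longlonglongrightarrow> ?w z"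
      proof (cases "z < 0")
        case True
        then have "(\<lambda>n. u (- (sqrt (t n) * - z)) - u (- sqrt (t n))) \<longlonglongrightarrow> 0"
          by (intro filterlim_compose[OF neg s]) simp
        from tendsto_add[OF this \<alpha>] show ?thesis using True by simp
      next
        case False
        with elim have "(\<lambda>n. u (sqrt (t n) * z) - u (sqrt (t n))) \<longlonglongrightarrow> 0"
          by (intro filterlim_compose[OF pos s]) simp
        from tendsto_add[OF this \<beta>] show ?thesis using False by simp
      qed
      then show ?case
        by (intro tendsto_mult_right_zero tendsto_rabs_zero LIM_zero)
    qed
  qed measurable
  then show "(\<lambda>n. LINT z|lborel. ?d n z) \<longlonglongrightarrow> 0" by simp
  show "\<bar>heat_semigroup (t n) u (sqrt (t n) * x) - (\<alpha> * F (- x) + \<beta> * F x)\<bar> \<le>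
      exp (L\<^sup>2 / 4) / (2 * sqrt pi) * (LINT z|lborel. ?d n z)" if "\<bar>x\<bar> \<le> L" for L n x
    using heat_step_bound[OF t(1) that] .
  show "(\<lambda>x. heat_semigroup (t n) u (sqrt (t n) * x)) \<in> borel_measurable lebesgue" for n
    using u_measurable t(1) by (rule heat_rescaled_measurable)
  show "(\<lambda>x. \<alpha> * F (- x) + \<beta> * F x) \<in> borel_measurable lebesgue"
    using F_combination_in_Linf_loc by (simp add: Linf_loc_def)
qed

end

section \<open>Comparison of the two sets of accumulation points\<close>

theorem corollary4:
  fixes u0 :: "real \<Rightarrow> real"
  assumes "bounded (range u0)"
    and "u0 C1_differentiable_on (- {0})"
    and "((\<lambda>x. \<bar>x * deriv u0 x\<bar>) \<longlongrightarrow> 0) at_infinity"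
  shows "Linf_loc_accumulation_points (\<lambda>t x. heat_semigroup t u0 (sqrt t * x)) =
         {Linf_loc_class (\<lambda>x. \<alpha> * F (- x) + \<beta> * F x) | \<alpha> \<beta>.
            (\<alpha>, \<beta>) \<in> accumulation_points (\<lambda>l. (u0 (- l), u0 l))}"
proof -
  obtain B where B: "\<And>x. \<bar>u0 x\<bar> \<le> B"
    using assms(1) by (auto simp: bounded_iff)
  \<comment> \<open>The vacuous case split separates the point 0, where \<open>u0\<close> may be
    discontinuous, from its complement, where it is continuous.\<close>
  have "(\<lambda>x. if x \<in> {0} then u0 x else u0 x) \<in> borel_measurable borel"
    using C1_differentiable_imp_continuous_on[OF assms(2)]
    by (intro borel_measurable_continuous_on_if) auto
  then have meas: "u0 \<in> borel_measurable borel" by simp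
  have deriv: "(u0 has_real_derivative deriv u0 x) (at x)" if "x \<noteq> 0" for x
    using assms(2) that unfolding C1_differentiable_on_def
    by (metis ComplI DERIV_imp_deriv has_real_derivative_iff_has_vector_derivative singletonD)
  have lim: "((\<lambda>x. x * deriv u0 x) \<longlongrightarrow> 0) at_infinity"
    using assms(3) by (simp only: tendsto_rabs_zero_iff)
  have pos: "((\<lambda>l. u0 (l * a) - u0 l) \<longlongrightarrow> 0) at_top" if "a > 0" for a
    using deriv tendsto_mono[OF at_top_le_at_infinity lim] that
    by (intro slowly_varying_at_top[where f' = "deriv u0"]) auto
  have neg: "((\<lambda>l. u0 (- (l * a)) - u0 (- l)) \<longlongrightarrow> 0) at_top" if "a > 0" for a
  proof (rule slowly_varying_at_top[where f' = "\<lambda>x. - deriv u0 (- x)", OF _ _ that])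
    show "((\<lambda>x. u0 (- x)) has_real_derivative - deriv u0 (- x)) (at x)" if "x > 0" for x
      using DERIV_chain2[OF deriv DERIV_minus[OF DERIV_ident], of x] that by simp
    show "((\<lambda>x. x * - deriv u0 (- x)) \<longlongrightarrow> 0) at_top"
      using filterlim_compose[OF tendsto_mono[OF at_bot_le_at_infinity lim] filterlim_uminus_at_bot_at_top]
      by simp
  qed
  note tendsto = heat_rescaled_tendsto[OF meas B pos neg]
  show ?thesis (is "?P = ?Q")
  proof
    show "?Q \<subseteq> ?P"
    proof safe
      fix \<alpha> \<beta> assume "(\<alpha>, \<beta>) \<in> accumulation_points (\<lambda>l. (u0 (- l), u0 l))"
      then obtain l :: "nat \<Rightarrow> real" where l: "\<And>n. 0 < l n" "filterlim l at_top sequentially"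
        and conv: "(\<lambda>n. (u0 (- l n), u0 (l n))) \<longlonglongrightarrow> (\<alpha>, \<beta>)"
        by (auto simp: accumulation_points_def)
      \<comment> \<open>Squaring makes the diffusive length \<open>sqrt (t n)\<close> equal to the
        given \<open>l n\<close>.\<close>
      define t where "t n = (l n)\<^sup>2" for n
      have t: "\<And>n. 0 < t n" "filterlim t at_top sequentially" and sqrt: "\<And>n. sqrt (t n) = l n"
        using l less_imp_le[OF l(1)] filterlim_pow_at_top[OF _ l(2), of 2]
        by (auto simp: t_def[abs_def] less_imp_neq[symmetric])
      have "Linf_loc_tendsto (\<lambda>n x. heat_semigroup (t n) u0 (sqrt (t n) * x)) (\<lambda>x. \<alpha> * F (- x) + \<beta> * F x)"
        using tendsto_fst[OF conv] tendsto_snd[OF conv] by (intro tendsto t) (auto simp: sqrt)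
      with t show "Linf_loc_class (\<lambda>x. \<alpha> * F (- x) + \<beta> * F x) \<in> ?P"
        using F_combination_in_Linf_loc unfolding Linf_loc_accumulation_points_def by blast
    qed
    show "?P \<subseteq> ?Q"
    proof
      fix X assume "X \<in> ?P"
      then obtain g t where X: "X = Linf_loc_class g" and t: "\<And>n. 0 < t n" "filterlim t at_top sequentially"
        and g: "Linf_loc_tendsto (\<lambda>n x. heat_semigroup (t n) u0 (sqrt (t n) * x)) g"
        by (auto simp: Linf_loc_accumulation_points_def)
      define p where "p n = (u0 (- sqrt (t n)), u0 (sqrt (t n)))" for n
      \<comment> \<open>Convergence of the heat flow along \<open>t\<close> does not directly give
        convergence of the pairs \<open>p n\<close>; compactness supplies it along a
        subsequence.\<close>
      have "bounded (range p)"
        by (rule bounded_subset[OF bounded_Times[OF assms(1) assms(1)]]) (auto simp: p_def)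
      then obtain q r where r: "strict_mono r" and "(p \<circ> r) \<longlonglongrightarrow> q"
        using bounded_imp_convergent_subsequence by blast
      then obtain \<alpha> \<beta> where conv: "(\<lambda>n. (u0 (- sqrt (t (r n))), u0 (sqrt (t (r n))))) \<longlonglongrightarrow> (\<alpha>, \<beta>)"
        by (cases q) (auto simp: p_def comp_def)
      let ?w = "\<lambda>x. \<alpha> * F (- x) + \<beta> * F x"
      have tr: "filterlim (\<lambda>n. t (r n)) at_top sequentially"
        using filterlim_compose[OF t(2) filterlim_subseq[OF r]] .
      have "Linf_loc_tendsto (\<lambda>n x. heat_semigroup (t (r n)) u0 (sqrt (t (r n)) * x)) ?w"
        using tendsto_fst[OF conv] tendsto_snd[OF conv] by (intro tendsto t tr) auto
      from Linf_loc_tendsto_imp_AE[OF this] Linf_loc_tendsto_imp_AE[OF g]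
      have "AE x in lebesgue. g x = ?w x"
      proof eventually_elim
        case (elim x)
        from LIMSEQ_subseq_LIMSEQ[OF elim(2) r] elim(1) show ?case
          by (auto simp: comp_def intro: LIMSEQ_unique)
      qed
      \<comment> \<open>Agreement almost everywhere suffices because the elements compared are
        classes.\<close>
      then have "X = Linf_loc_class ?w"
        unfolding X Linf_loc_class_def by (auto elim: eventually_elim2)
      moreover have "(\<alpha>, \<beta>) \<in> accumulation_points (\<lambda>l. (u0 (- l), u0 l))"
        unfolding accumulation_points_def
        using t(1) conv filterlim_compose[OF sqrt_at_top tr]
        by (intro CollectI exI[of _ "\<lambda>n. sqrt (t (r n))"]) auto
      ultimately show "X \<in> ?Q" by blast
    qed
  qed
qed

end
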